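(* Let $\mathfrak M=(G,M,I,v)$ be a context-based model and let $\overline I=(G\times M)\setminus I$. Then: (a) $I$ and $\overline I$ are partial functions (from $G$ to $M$) iff $\mathfrak M\models_{s_1}\neg\Diamond^1_{\mathfrak p}\top_{s_2}$ and $\mathfrak M\models_{s_1}\neg\overline\Diamond^1_{\mathfrak p}\top_{s_2}$, respectively. (b) $I$ and $\overline I$ are functions iff $\mathfrak M\models_{s_1}\Diamond^1_{\mathfrak p}!\top_{s_2}$ and $\mathfrak M\models_{s_1}\overline\Diamond^1_{\mathfrak p}!\top_{s_2}$, respectively. (c) $I$ is an injective function iff $\mathfrak M\models_{s_1}\Diamond^1_{\mathfrak p}!\top_{s_2}$ and $\mathfrak M\models_{s_2}\neg\Diamond^1_{\mathfrak o}\top_{s_1}$. (d) $\overline I$ is an injective function iff $\mathfrak M\models_{s_1}\overline\Diamond^1_{\mathfrak p}!\top_{s_2}$ and $\mathfrak M\models_{s_2}\neg\overline\Diamond^1_{\mathfrak o}\top_{s_1}$. (e) $I$ is a surjective function iff $\mathfrak M\models_{s_1}\Diamond^1_{\mathfrak p}!\top_{s_2}$ and $\mathfrak M\models_{s_2}\Diamond^0_{\mathfrak o}\top_{s_1}$. (f) $\overline I$ is a surjective function iff $\mathfrak M\models_{s_1}\overline\Diamond^1_{\mathfrak p}!\top_{s_2}$ and $\mathfrak M\models_{s_2}\overline\Diamond^0_{\mathfrak o}\top_{s_1}$. (g) $I$ is a bijective function iff $\mathfrak M\models_{s_2}\Diamond^1_{\mathfrak o}!\top_{s_1}$ and $\mathfrak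 M\models_{s_1}\Diamond^1_{\mathfrak p}!\top_{s_2}$. (h) $\overline I$ is a bijective function iff $\mathfrak M\models_{s_2}\overline\Diamond^1_{\mathfrak o}!\top_{s_1}$ and $\mathfrak M\models_{s_1}\overline\Diamond^1_{\mathfrak p}!\top_{s_2}$.
   Context: A context is a triple $(G,M,I)$, $G,M$ sets, $I\subseteq G\times M$. A context-based model is $\mathfrak M=(G,M,I,v)$ where $v$ assigns to each propositional variable of sort $s_1$ a subset of $G$ and to each one of sort $s_2$ a subset of $M$ (the two sets of variables are disjoint). Graded formulas, for $n\in\mathbb N$ (including $0$): sort $s_1$: $\varphi::=p\mid\varphi\wedge\varphi\mid\varphi\vee\varphi\mid\neg\varphi\mid\Box^n_{\mathfrak p}\psi\mid\boxminus^n_{\mathfrak p}\psi$ with $\psi$ of sort $s_2$; sort $s_2$: $\psi::=q\mid\psi\wedge\psi\mid\psi\vee\psi\mid\neg\psi\mid\Box^n_{\mathfrak o}\varphi\mid\boxminus^n_{\mathfrak o}\varphi$ with $\varphi$ of sort $s_1$. $\top_{s_i}$ is verum of sort $s_i$. Sort-$s_1$ formulas are evaluated at $g\in G$, sort-$s_2$ formulas at $m\in M$. For $R\in\{I,\overline I\}$ let $R_{g\bullet}(\psi)=\{m\in M: Rgm,\ m\models\psi\}$ and $R_{\bullet m}(\varphi)=\{g\in G: Rgm,\ g\models\varphi\}$. Variables are interpreted by $v$, Boolean connectives classically, and: $m\models\Box^n_{\mathfrak o}\varphi$ iff $|I_{\bullet m}(\neg\varphi)|\le n$; $m\models\boxminus^n_{\mathfrak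 o}\varphi$ iff $|\overline I_{\bullet m}(\varphi)|\le n$; $g\models\Box^n_{\mathfrak p}\psi$ iff $|I_{g\bullet}(\neg\psi)|\le n$; $g\models\boxminus^n_{\mathfrak p}\psi$ iff $|\overline I_{g\bullet}(\psi)|\le n$. Derived modalities: $\overline\Box^n_{\mathfrak o}\varphi:=\boxminus^n_{\mathfrak o}\neg\varphi$, $\overline\Box^n_{\mathfrak p}\psi:=\boxminus^n_{\mathfrak p}\neg\psi$; $\Diamond^n_{\mathfrak o}\varphi:=\neg\Box^n_{\mathfrak o}\neg\varphi$, $\Diamond^n_{\mathfrak p}\psi:=\neg\Box^n_{\mathfrak p}\neg\psi$, $\overline\Diamond^n_{\mathfrak o}\varphi:=\neg\overline\Box^n_{\mathfrak o}\neg\varphi$, $\overline\Diamond^n_{\mathfrak p}\psi:=\neg\overline\Box^n_{\mathfrak p}\neg\psi$. For $n\ge1$ and $\Diamond$ any of these four diamonds, $\Diamond^n!\chi:=\Diamond^{n-1}\chi\wedge\neg\Diamond^n\chi$. $\mathfrak M\models_{s_i}\chi$ means that $\chi$ (of sort $s_i$) is satisfied at every point of sort $s_i$ of $\mathfrak M$. A relation $R\subseteq G\times M$ is a partial function if each $g\in G$ is $R$-related to at most one $m\in M$, and a function if each $g$ is related to exactly one $m$; injective, surjective, bijective refer to the function $G\to M$ so defined. *)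

theory Defs
  imports Main
begin

(* The two disjoint sets of propositional variables are the types 'p (sort s1) and 'q (sort s2). *)
datatype ('p, 'q) form1 =
    Var1 'p
  | And1 "('p, 'q) form1" "('p, 'q) form1"
  | Or1 "('p, 'q) form1" "('p, 'q) form1"
  | Not1 "('p, 'q) form1"
  | BoxP nat "('p, 'q) form2"
  | BoxMinusP nat "('p, 'q) form2"
and ('p, 'q) form2 =
    Var2 'q
  | And2 "('p, 'q) form2" "('p, 'q) form2"
  | Or2 "('p, 'q) form2" "('p, 'q) form2"
  | Not2 "('p, 'q) form2"
  | BoxO nat "('p, 'q) form1"
  | BoxMinusO nat "('p, 'q) form1"

(* Verum is not in the grammar; it is the instance of excluded middle at some variable. *)
definition Top1 :: "('p, 'q) form1" where
  "Top1 = (let p = (SOME p. True) in Or1 (Var1 p) (Not1 (Var1 p)))"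

definition Top2 :: "('p, 'q) form2" where
  "Top2 = (let q = (SOME q. True) in Or2 (Var2 q) (Not2 (Var2 q)))"

definition BarBoxO :: "nat \<Rightarrow> ('p, 'q) form1 \<Rightarrow> ('p, 'q) form2" where
  "BarBoxO n \<phi> = BoxMinusO n (Not1 \<phi>)"

definition BarBoxP :: "nat \<Rightarrow> ('p, 'q) form2 \<Rightarrow> ('p, 'q) form1" where
  "BarBoxP n \<psi> = BoxMinusP n (Not2 \<psi>)"

definition DiaO :: "nat \<Rightarrow> ('p, 'q) form1 \<Rightarrow> ('p, 'q) form2" where
  "DiaO n \<phi> = Not2 (BoxO n (Not1 \<phi>))"

definition DiaP :: "nat \<Rightarrow> ('p, 'q) form2 \<Rightarrow> ('p, 'q) form1" where
  "DiaP n \<psi> = Not1 (BoxP n (Not2 \<psi>))"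

definition BarDiaO :: "nat \<Rightarrow> ('p, 'q) form1 \<Rightarrow> ('p, 'q) form2" where
  "BarDiaO n \<phi> = Not2 (BarBoxO n (Not1 \<phi>))"

definition BarDiaP :: "nat \<Rightarrow> ('p, 'q) form2 \<Rightarrow> ('p, 'q) form1" where
  "BarDiaP n \<psi> = Not1 (BarBoxP n (Not2 \<psi>))"

(* The exact diamonds are meant for n \<ge> 1 only. *)
definition DiaExactO :: "nat \<Rightarrow> ('p, 'q) form1 \<Rightarrow> ('p, 'q) form2" where
  "DiaExactO n \<phi> = And2 (DiaO (n - 1) \<phi>) (Not2 (DiaO n \<phi>))"

definition DiaExactP :: "nat \<Rightarrow> ('p, 'q) form2 \<Rightarrow> ('p, 'q) form1" where
  "DiaExactP n \<psi> = And1 (DiaP (n - 1) \<psi>) (Not1 (DiaP n \<psi>))"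

definition BarDiaExactO :: "nat \<Rightarrow> ('p, 'q) form1 \<Rightarrow> ('p, 'q) form2" where
  "BarDiaExactO n \<phi> = And2 (BarDiaO (n - 1) \<phi>) (Not2 (BarDiaO n \<phi>))"

definition BarDiaExactP :: "nat \<Rightarrow> ('p, 'q) form2 \<Rightarrow> ('p, 'q) form1" where
  "BarDiaExactP n \<psi> = And1 (BarDiaP (n - 1) \<psi>) (Not1 (BarDiaP n \<psi>))"

record ('g, 'm, 'p, 'q) cmodel =
  objs :: "'g set"
  feats :: "'m set"
  incid :: "('g \<times> 'm) set"
  val1 :: "'p \<Rightarrow> 'g set"
  val2 :: "'q \<Rightarrow> 'm set"

definition context_based_model :: "('g, 'm, 'p, 'q) cmodel \<Rightarrow> bool" where
  "context_based_model \<MM> \<longleftrightarrow>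
     incid \<MM> \<subseteq> objs \<MM> \<times> feats \<MM> \<and>
     (\<forall>p. val1 \<MM> p \<subseteq> objs \<MM>) \<and> (\<forall>q. val2 \<MM> q \<subseteq> feats \<MM>)"

definition coincid :: "('g, 'm, 'p, 'q) cmodel \<Rightarrow> ('g \<times> 'm) set" where
  "coincid \<MM> = (objs \<MM> \<times> feats \<MM>) - incid \<MM>"

(* Finiteness is required explicitly because card is 0 on infinite sets. *)
definition card_le :: "'a set \<Rightarrow> nat \<Rightarrow> bool" where
  "card_le A n \<longleftrightarrow> finite A \<and> card A \<le> n"

primrec sat1 :: "('g, 'm, 'p, 'q) cmodel \<Rightarrow> 'g \<Rightarrow> ('p, 'q) form1 \<Rightarrow> bool"
  and sat2 :: "('g, 'm, 'p, 'q) cmodel \<Rightarrow> 'm \<Rightarrow> ('p, 'q) form2 \<Rightarrow> bool"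
where
  "sat1 \<MM> g (Var1 p) = (g \<in> val1 \<MM> p)"
| "sat1 \<MM> g (And1 \<phi> \<chi>) = (sat1 \<MM> g \<phi> \<and> sat1 \<MM> g \<chi>)"
| "sat1 \<MM> g (Or1 \<phi> \<chi>) = (sat1 \<MM> g \<phi> \<or> sat1 \<MM> g \<chi>)"
| "sat1 \<MM> g (Not1 \<phi>) = (\<not> sat1 \<MM> g \<phi>)"
| "sat1 \<MM> g (BoxP n \<psi>) =
     card_le {m \<in> feats \<MM>. (g, m) \<in> incid \<MM> \<and> \<not> sat2 \<MM> m \<psi>} n"
| "sat1 \<MM> g (BoxMinusP n \<psi>) =
     card_le {m \<in> feats \<MM>. (g, m) \<in> coincid \<MM> \<and> sat2 \<MM> m \<psi>} n"
| "sat2 \<MM> m (Var2 q) = (m \<in> val2 \<MM> q)"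
| "sat2 \<MM> m (And2 \<psi> \<chi>) = (sat2 \<MM> m \<psi> \<and> sat2 \<MM> m \<chi>)"
| "sat2 \<MM> m (Or2 \<psi> \<chi>) = (sat2 \<MM> m \<psi> \<or> sat2 \<MM> m \<chi>)"
| "sat2 \<MM> m (Not2 \<psi>) = (\<not> sat2 \<MM> m \<psi>)"
| "sat2 \<MM> m (BoxO n \<phi>) =
     card_le {g \<in> objs \<MM>. (g, m) \<in> incid \<MM> \<and> \<not> sat1 \<MM> g \<phi>} n"
| "sat2 \<MM> m (BoxMinusO n \<phi>) =
     card_le {g \<in> objs \<MM>. (g, m) \<in> coincid \<MM> \<and> sat1 \<MM> g \<phi>} n"

definition valid1 :: "('g, 'm, 'p, 'q) cmodel \<Rightarrow> ('p, 'q) form1 \<Rightarrow> bool" where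
  "valid1 \<MM> \<phi> \<longleftrightarrow> (\<forall>g \<in> objs \<MM>. sat1 \<MM> g \<phi>)"

definition valid2 :: "('g, 'm, 'p, 'q) cmodel \<Rightarrow> ('p, 'q) form2 \<Rightarrow> bool" where
  "valid2 \<MM> \<psi> \<longleftrightarrow> (\<forall>m \<in> feats \<MM>. sat2 \<MM> m \<psi>)"

definition partial_function_rel :: "'g set \<Rightarrow> 'm set \<Rightarrow> ('g \<times> 'm) set \<Rightarrow> bool" where
  "partial_function_rel G M R \<longleftrightarrow> (\<forall>g \<in> G. \<exists>\<^sub>\<le>\<^sub>1 m. m \<in> M \<and> (g, m) \<in> R)"

definition function_rel :: "'g set \<Rightarrow> 'm set \<Rightarrow> ('g \<times> 'm) set \<Rightarrow> bool" where
  "function_rel G M R \<longleftrightarrow> (\<forall>g \<in> G. \<exists>! m. m \<in> M \<and> (g, m) \<in> R)"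

(* Meaningful only on G, and only if function_rel G M R holds. *)
definition fun_of_rel :: "'m set \<Rightarrow> ('g \<times> 'm) set \<Rightarrow> 'g \<Rightarrow> 'm" where
  "fun_of_rel M R g = (THE m. m \<in> M \<and> (g, m) \<in> R)"

definition injective_function_rel :: "'g set \<Rightarrow> 'm set \<Rightarrow> ('g \<times> 'm) set \<Rightarrow> bool" where
  "injective_function_rel G M R \<longleftrightarrow> function_rel G M R \<and> inj_on (fun_of_rel M R) G"

definition surjective_function_rel :: "'g set \<Rightarrow> 'm set \<Rightarrow> ('g \<times> 'm) set \<Rightarrow> bool" where
  "surjective_function_rel G M R \<longleftrightarrow> function_rel G M R \<and> fun_of_rel M R ` G = M"

definition bijective_function_rel :: "'g set \<Rightarrow> 'm set \<Rightarrow> ('g \<times> 'm) set \<Rightarrow> bool" where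
  "bijective_function_rel G M R \<longleftrightarrow> function_rel G M R \<and> bij_betw (fun_of_rel M R) G M"

end

theory Submission
  imports Defs
begin

text \<open>Since verum holds at every point, a graded diamond of verum merely counts:
  \<open>DiaP n Top2\<close> holds at g iff g has more than n (possibly infinitely many) related
  features, and \<open>DiaO n Top1\<close> counts objects related to m. The barred diamonds do the
  same for the complement. Only grades 0 and 1 occur, expressing nonemptiness and, negated, having
  at most one element. Being a function is such a condition on the rows of the relation; for a
  function, injectivity and surjectivity say that each column has at most, respectively at least,
  one element (\<open>injective_function_rel_iff\<close>,
  \<open>surjective_function_rel_iff\<close>).\<close>

lemma card_le_0_iff: "card_le A 0 \<longleftrightarrow> A = {}"
  by (auto simp: card_le_def)

lemma card_le_1_iff: "card_le A 1 \<longleftrightarrow> (\<forall>x\<in>A. \<forall>y\<in>A. x = y)"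
proof
  assume "card_le A 1"
  then show "\<forall>x\<in>A. \<forall>y\<in>A. x = y"
    using card_le_Suc0_iff_eq[of A] by (simp add: card_le_def)
next
  assume eq: "\<forall>x\<in>A. \<forall>y\<in>A. x = y"
  \<comment> \<open>\<open>card_le\<close> demands finiteness separately; here A lies inside a
    singleton.\<close>
  then have "finite A"
    by (metis finite.simps finite_subset singletonI subsetI)
  with eq show "card_le A 1"
    using card_le_Suc0_iff_eq[of A] by (simp add: card_le_def)
qed

lemma sat1_Top1 [simp]: "sat1 \<MM> g Top1"
  by (simp add: Top1_def Let_def)

lemma sat2_Top2 [simp]: "sat2 \<MM> m Top2"
  by (simp add: Top2_def Let_def)

lemma sat1_DiaP_Top2:
  "sat1 \<MM> g (DiaP n Top2) \<longleftrightarrow> \<not> card_le {m \<in> feats \<MM>. (g, m) \<in> incid \<MM>} n"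
  by (simp add: DiaP_def)

lemma sat1_BarDiaP_Top2:
  "sat1 \<MM> g (BarDiaP n Top2) \<longleftrightarrow> \<not> card_le {m \<in> feats \<MM>. (g, m) \<in> coincid \<MM>} n"
  by (simp add: BarDiaP_def BarBoxP_def)

lemma sat2_DiaO_Top1:
  "sat2 \<MM> m (DiaO n Top1) \<longleftrightarrow> \<not> card_le {g \<in> objs \<MM>. (g, m) \<in> incid \<MM>} n"
  by (simp add: DiaO_def)

lemma sat2_BarDiaO_Top1:
  "sat2 \<MM> m (BarDiaO n Top1) \<longleftrightarrow> \<not> card_le {g \<in> objs \<MM>. (g, m) \<in> coincid \<MM>} n"
  by (simp add: BarDiaO_def BarBoxO_def)

lemma partial_function_rel_iff:
  "partial_function_rel G M R \<longleftrightarrow> (\<forall>g\<in>G. card_le {m \<in> M. (g, m) \<in> R} 1)"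
  unfolding partial_function_rel_def card_le_1_iff Uniq_def by blast

lemma function_rel_iff:
  "function_rel G M R \<longleftrightarrow>
    (\<forall>g\<in>G. \<not> card_le {m \<in> M. (g, m) \<in> R} 0 \<and> card_le {m \<in> M. (g, m) \<in> R} 1)"
  unfolding function_rel_def card_le_0_iff card_le_1_iff by blast

text \<open>Unique existence makes the description in \<open>fun_of_rel\<close> denote, so equations
  between values can be traded for membership in R.\<close>

lemma fun_of_rel_eq_iff:
  assumes "function_rel G M R" "g \<in> G"
  shows "fun_of_rel M R g = m \<longleftrightarrow> m \<in> M \<and> (g, m) \<in> R"
proof -
  have ex1: "\<exists>!m. m \<in> M \<and> (g, m) \<in> R"
    using assms by (simp add: function_rel_def)
  show ?thesis
    unfolding fun_of_rel_def using theI'[OF ex1] the1_equality[OF ex1] by metis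
qed

lemma injective_function_rel_iff:
  "injective_function_rel G M R \<longleftrightarrow>
    function_rel G M R \<and> (\<forall>m\<in>M. card_le {g \<in> G. (g, m) \<in> R} 1)"
proof (cases "function_rel G M R")
  case True
  note f = fun_of_rel_eq_iff[OF True]
  \<comment> \<open>Two objects have the same value exactly when they share a column m, namely that
    value.\<close>
  have "inj_on (fun_of_rel M R) G \<longleftrightarrow>
      (\<forall>m\<in>M. \<forall>x\<in>G. \<forall>y\<in>G. (x, m) \<in> R \<longrightarrow> (y, m) \<in> R \<longrightarrow> x = y)"
    unfolding inj_on_def using f by metis
  then show ?thesis
    using True unfolding injective_function_rel_def card_le_1_iff by blast
qed (simp add: injective_function_rel_def)

lemma surjective_function_rel_iff:
  "surjective_function_rel G M R \<longleftrightarrow>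
    function_rel G M R \<and> (\<forall>m\<in>M. \<not> card_le {g \<in> G. (g, m) \<in> R} 0)"
proof (cases "function_rel G M R")
  case True
  note f = fun_of_rel_eq_iff[OF True]
  \<comment> \<open>The image consists of the nonempty columns, so it equals M iff no column is
    empty.\<close>
  have "fun_of_rel M R ` G = {m \<in> M. \<exists>g\<in>G. (g, m) \<in> R}"
    unfolding image_def using f by (metis (no_types, lifting))
  then show ?thesis
    using True unfolding surjective_function_rel_def card_le_0_iff by blast
qed (simp add: surjective_function_rel_def)

lemma bijective_function_rel_iff:
  "bijective_function_rel G M R \<longleftrightarrow>
    injective_function_rel G M R \<and> surjective_function_rel G M R"
  by (auto simp: bijective_function_rel_def injective_function_rel_def
      surjective_function_rel_def bij_betw_def)

theorem theorem6p6:
  fixes \<MM> :: "('g, 'm, 'p, 'q) cmodel"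
    and G :: "'g set" and M :: "'m set" and I J :: "('g \<times> 'm) set"
  assumes "context_based_model \<MM>"
    and "G = objs \<MM>" and "M = feats \<MM>" and "I = incid \<MM>" and "J = (G \<times> M) - I"
  shows
    "(partial_function_rel G M I \<longleftrightarrow> valid1 \<MM> (Not1 (DiaP 1 Top2))) \<and>
     (partial_function_rel G M J \<longleftrightarrow> valid1 \<MM> (Not1 (BarDiaP 1 Top2))) \<and>
     (function_rel G M I \<longleftrightarrow> valid1 \<MM> (DiaExactP 1 Top2)) \<and>
     (function_rel G M J \<longleftrightarrow> valid1 \<MM> (BarDiaExactP 1 Top2)) \<and>
     (injective_function_rel G M I \<longleftrightarrow>
        valid1 \<MM> (DiaExactP 1 Top2) \<and> valid2 \<MM> (Not2 (DiaO 1 Top1))) \<and>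
     (injective_function_rel G M J \<longleftrightarrow>
        valid1 \<MM> (BarDiaExactP 1 Top2) \<and> valid2 \<MM> (Not2 (BarDiaO 1 Top1))) \<and>
     (surjective_function_rel G M I \<longleftrightarrow>
        valid1 \<MM> (DiaExactP 1 Top2) \<and> valid2 \<MM> (DiaO 0 Top1)) \<and>
     (surjective_function_rel G M J \<longleftrightarrow>
        valid1 \<MM> (BarDiaExactP 1 Top2) \<and> valid2 \<MM> (BarDiaO 0 Top1)) \<and>
     (bijective_function_rel G M I \<longleftrightarrow>
        valid2 \<MM> (DiaExactO 1 Top1) \<and> valid1 \<MM> (DiaExactP 1 Top2)) \<and>
     (bijective_function_rel G M J \<longleftrightarrow>
        valid2 \<MM> (BarDiaExactO 1 Top1) \<and> valid1 \<MM> (BarDiaExactP 1 Top2))"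
proof -
  have J: "J = coincid \<MM>"
    using assms by (simp add: coincid_def)
  note sats = sat1_DiaP_Top2 sat1_BarDiaP_Top2 sat2_DiaO_Top1 sat2_BarDiaO_Top1
  note rels = partial_function_rel_iff function_rel_iff injective_function_rel_iff
    surjective_function_rel_iff bijective_function_rel_iff
  show ?thesis
    \<comment> \<open>\<open>diff_self_eq_0\<close> reduces the grade \<open>1 - 1\<close> to 0, and
      \<open>ball_conj_distrib\<close> splits exact diamonds into separate row or column conditions.
      Both sides then combine the same bounded statements, and only propositional reasoning
      remains.\<close>
    unfolding J assms(2-4) rels valid1_def valid2_def DiaExactP_def BarDiaExactP_def
      DiaExactO_def BarDiaExactO_def sat1.simps sat2.simps sats diff_self_eq_0 not_not
      ball_conj_distrib
    by argo
qed

end
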